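(* Consider the real-analytic vector field $$\dot x=\omega(y)+\varepsilon h_{10,y}(y,x,t)+\mu f_{01}(y,x,t),\qquad \dot y=-\varepsilon h_{10,x}(y,x,t)+\mu\big(g_{01}(y,x,t)-\eta(y,x,t)\big)\qquad(\ast)$$ defined on $A\times\mathbb{T}^{\ell+1}$ (with $A\subseteq\mathbb{R}^\ell$ open) and with complex extension to $C_{r_0}(A)\times C_{s_0}(\mathbb{T}^{\ell+1})$, $r_0,s_0>0$. Let $D\subseteq A$ be such that, for some $K\in\mathbb{Z}_+$ and $a>0$, $$|\omega(y)\cdot k+m|\ge a\quad\text{for all } y\in D,\ k\in\mathbb{Z}^\ell,\ m\in\mathbb{Z},\ |k|+|m|\le K .$$ Assume that there exist $\varepsilon_0,\mu_0$ such that for $\varepsilon\le\varepsilon_0$, $|\mu|\le\mu_0$ the Normal Form Lemma (whose conclusions are written out in the context) holds, $\eta$ being the corresponding drift function. Then there exist positive parameters $\rho_0,\tau_0>0$ such that for every solution $(y(t),x(t))$ of $(\ast)$ at time $t>0$ with initial position $(y(0),x(0))\in D\times\mathbb{T}^\ell$ one has, for $\lambda\equiv\max(\varepsilon,|\mu|)$, $$\|y(t)-y(0)\|\le\rho_0\lambda\qquad\text{for}\qquad t\le C_t\,e^{K\tau_0},$$ for some positive constant $C_t$, where $\rho_0$ and $C_t$ depend on $r_0,s_0,N,K,\varepsilon_0,\mu_0$ and on the norms of $\omega,h_{10},f_{01},g_{01}$.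
   Context: Setting. $\ell\ge1$; $y\in A$, $(x,t)\in\mathbb{T}^{\ell+1}$, $\mathbb{T}=\mathbb{R}/2\pi\mathbb{Z}$; $\varepsilon\in\mathbb{R}_+$ (perturbing parameter), $\mu\in\mathbb{R}\setminus\{0\}$ (dissipative parameter). $\omega=\omega(y)$ and $\eta=\eta(y,x,t)$ are real-analytic and $\mathbb{R}^\ell$-valued; $h_{10}$ is a known scalar function and $f_{01},g_{01}$ are known $\mathbb{R}^\ell$-valued functions, periodic and real-analytic on $A\times\mathbb{T}^{\ell+1}$. For $\mu=0$ the field is the Hamiltonian field of $h_{00}(y)+\varepsilon h_{10}(y,x,t)$, with $\omega=h_{00,y}$. For $\mu\ne0$ the vector field is assumed dissipative (a subset of phase space is asymptotically contracted or expanded by the time evolution into a compact set); systems whose energy oscillates around a mean value are also allowed. The drift $\eta$ is an unknown to be chosen; its components are expanded as $\eta^{(k)}(y,x,t)=\sum_{m\ge0}\sum_{j=0}^m\eta^{(k)}_{j,m-j+1}(y,x,t)\varepsilon^j\mu^{m-j}$, $k=1,\dots,\ell$. Notation. Subscripts $x,y,t$ after a comma (or alone) denote derivatives. $|k|=|k_1|+\dots+|k_\ell|$ for $k\in\mathbb{Z}^\ell$. $F\in O_k(\varepsilon,\mu)$ means the Taylor expansion of $F$ in $\varepsilon,\mu$ contains only powers $\varepsilon^j\mu^m$ with $j+m\ge k$. For $f(y,x,t)=\sum_{(k,m)\in\mathbb{Z}^{\ell+1}}\hat f_{km}(y)e^{i(k\cdot x+mt)}$, $f^{>K}$ is the sum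 restricted to $|k|+|m|>K$. Domains and norms. $C_{r_0}(A)=\{y\in\mathbb{C}^\ell:\|y-y_A\|\le r_0\text{ for some }y_A\in A\}$ ($\|\cdot\|$ Euclidean); $C_{s_0}(\mathbb{T}^{\ell+1})=\{(x,t)\in\mathbb{C}^{\ell+1}:\max_j|\Im x_j|\le s_0,\ |\Im t|\le s_0\}$. $\|f\|_{r_0,s_0}=\sup_{y\in C_{r_0}(A)}\sum_{(k,m)}|\hat f_{km}(y)|e^{(|k|+|m|)s_0}$ for scalar $f$; for a vector function $v$, $\|v\|_{r_0,s_0}=(\sum_j\|v_j\|_{r_0,s_0}^2)^{1/2}$; for $g=g(y)$, $\|g\|_{r_0}=\sup_{y\in C_{r_0}(A)}\|g(y)\|$. "The Normal Form Lemma holds" for $\varepsilon\le\varepsilon_0$, $|\mu|\le\mu_0$ means: there exists a drift function $\eta$ such that for all such $\varepsilon,\mu$ there is a coordinate transformation close to the identity $\Xi^{(N)}=\Xi_d^{(N)}\circ\Xi_c^{(N)}:A\times\mathbb{T}^{\ell+1}\to\mathbb{R}^\ell\times\mathbb{T}^{\ell+1}$, $(Y,X,t)=\Xi^{(N)}(y,x,t)$, acting as the identity on $t$, invertible as $y=y(Y,X,t)$, $x=x(Y,X,t)$, for a suitable normalization order $N\in\mathbb{Z}_+$, which brings $(\ast)$ into the form $$\begin{aligned}\dot X&=\Omega_d^{(N)}(Y;\varepsilon,\mu)+F_{N+1}(Y,X,t)+F_{01}^{>K}(Y,X,t)+\varepsilon h^{>K}_{10,y}(y(Y,X,t),x(Y,X,t),t)+\mu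 f^{>K}_{01}(y(Y,X,t),x(Y,X,t),t),\\ \dot Y&=G_{N+1}(Y,X,t)+G_{01}^{>K}(Y,X,t)-\varepsilon h^{>K}_{10,x}(y(Y,X,t),x(Y,X,t),t)+\mu g^{>K}_{01}(y(Y,X,t),x(Y,X,t),t),\end{aligned}$$ with $F_{N+1},G_{N+1}$ of order $O_{N+1}(\varepsilon,\mu)$, $F_{01}^{>K},G_{01}^{>K}$ of order $O_1(\varepsilon,\mu)$, $\Omega_d^{(N)}(Y;\varepsilon,\mu)=\omega(Y)+\sum_{m=0}^N\sum_{j=0}^m\Omega_{j,m-j}(Y)\varepsilon^j\mu^{m-j}$, $\Omega_{00}=0$, and, with $\lambda=\max(\varepsilon,|\mu|)$: (1) for $\tilde r_0<r_0$, $\|\Omega_d^{(N)}-\omega\|_{\tilde r_0}\le C_\omega\lambda$; (2) for $R_0<r_0$, $S_0<s_0$, $$\|G_{N+1}\|_{R_0,S_0}+\|G^{>K}_{01}\|_{R_0,S_0}+\varepsilon\|h^{>K}_{10,x}\|_{R_0,S_0}+|\mu|\,\|g^{>K}_{01}\|_{R_0,S_0}\le C_Y\lambda^{N+1},$$ which, choosing $N=[K\tau_0/|\log\lambda|]$ for some $\tau_0>0$ ($[\cdot]$ the integer part; the choice comes from the relation $\lambda^N=e^{-K\tau_0}$), becomes $\le C_Y\lambda e^{-K\tau_0}$; (3) $\|\Pi_y(\Xi_d^{(N)}\circ\Xi_c^{(N)})-\mathrm{Id}\|\le C_p\lambda$, $\Pi_y$ being the projection on the $y$-coordinate. Here $C_\omega,C_Y,C_p$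 are positive constants depending on $r_0,s_0,N,K$ and the norms of $\omega,h_{10},f_{01},g_{01}$. Form of the transformation: $(\tilde y,\tilde x,t)=\Xi_c^{(N)}(y,x,t)$ is implicitly defined by $\tilde x=x+\sum_{j=1}^N\psi_{j0,y}(\tilde y,x,t)\varepsilon^j$, $y=\tilde y+\sum_{j=1}^N\psi_{j0,x}(\tilde y,x,t)\varepsilon^j$ for generating functions $\psi_{j0}$, and $(Y,X,t)=\Xi_d^{(N)}(\tilde y,\tilde x,t)$ is defined by $X=\tilde x+\sum_{m=0}^N\sum_{j=0}^m\alpha_{j,m-j}(\tilde y,\tilde x,t)\varepsilon^j\mu^{m-j}$, $Y=\tilde y+\sum_{m=0}^N\sum_{j=0}^m\beta_{j,m-j}(\tilde y,\tilde x,t)\varepsilon^j\mu^{m-j}$, with $\alpha_{i0}=\beta_{i0}=0$ for all $i\ge 0$ and all $\alpha_{ij},\beta_{ij}$ of zero average over $(\tilde x,t)$. *)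

theory Defs
  imports "HOL-Analysis.Analysis"
begin

section \<open>Phase space and complex domains\<close>

text \<open>
  Points are triples \<open>(y, x, t)\<close>. The torus \<open>\<real>/2\<pi>\<int>\<close> is represented by its universal cover: angles are
  real (or complex) numbers, functions on the torus are \<open>2\<pi>\<close>-periodic, and maps between tori are
  lifts commuting with the deck transformations \<open>shift\<close>. The dimension \<open>\<ell>\<close> is \<open>CARD('n)\<close>.
\<close>

type_synonym ('a, 'n) phase = "('a, 'n) vec \<times> ('a, 'n) vec \<times> 'a"

type_synonym 'n mode = "(int, 'n) vec \<times> int"

definition cvec :: "real ^ 'n \<Rightarrow> complex ^ 'n" where
  "cvec v = (\<chi> i. complex_of_real (v $ i))"

definition re_vec :: "complex ^ 'n \<Rightarrow> real ^ 'n" where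
  "re_vec v = (\<chi> i. Re (v $ i))"

definition cphase :: "(real, 'n::finite) phase \<Rightarrow> (complex, 'n) phase" where
  "cphase p = (case p of (y, x, t) \<Rightarrow> (cvec y, cvec x, complex_of_real t))"

definition rdom :: "(real ^ 'n) set \<Rightarrow> (real, 'n) phase set" where
  "rdom A = A \<times> UNIV \<times> UNIV"

definition C_act :: "real \<Rightarrow> (real ^ 'n) set \<Rightarrow> (complex ^ 'n) set" where
  "C_act r A = {y. \<exists>a\<in>A. norm (y - cvec a) \<le> r}"

definition C_ang :: "real \<Rightarrow> ((complex ^ 'n) \<times> complex) set" where
  "C_ang s = {(x, t). (\<forall>j. \<bar>Im (x $ j)\<bar> \<le> s) \<and> \<bar>Im t\<bar> \<le> s}"

definition cdom :: "(real ^ 'n) set \<Rightarrow> real \<Rightarrow> real \<Rightarrow> (complex, 'n) phase set" where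
  "cdom A r s = C_act r A \<times> C_ang s"

definition shift :: "'n mode \<Rightarrow> ('a::real_normed_field, 'n::finite) phase \<Rightarrow> ('a, 'n) phase" where
  "shift km p = (case (km, p) of ((k, m), (y, x, t)) \<Rightarrow>
     (y, x + (\<chi> i. of_real (2 * pi * of_int (k $ i))), t + of_real (2 * pi * of_int m)))"

definition periodic_on :: "(('a::real_normed_field, 'n::finite) phase \<Rightarrow> 'b) \<Rightarrow> ('a, 'n) phase set \<Rightarrow> bool" where
  "periodic_on f S \<longleftrightarrow> (\<forall>p\<in>S. \<forall>km. f (shift km p) = f p)"

section \<open>Analyticity and partial derivatives\<close>

definition cscale :: "complex \<Rightarrow> (complex, 'n::finite) phase \<Rightarrow> (complex, 'n) phase" where
  "cscale c p = (case p of (y, x, t) \<Rightarrow> (c *s y, c *s x, c * t))"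

text \<open>
  Several-variable counterpart of the library's \<open>analytic_on\<close>: complex differentiability (a Frechet
  derivative that is complex linear) on an open neighbourhood of the set.
\<close>

definition canalytic_on :: "((complex, 'n::finite) phase \<Rightarrow> complex) \<Rightarrow> (complex, 'n) phase set \<Rightarrow> bool" where
  "canalytic_on f S \<longleftrightarrow> (\<exists>U. open U \<and> S \<subseteq> U \<and>
     (\<forall>p\<in>U. \<exists>f'. (f has_derivative f') (at p) \<and> (\<forall>c v. f' (cscale c v) = c * f' v)))"

definition canalytic_vec_on :: "((complex, 'n::finite) phase \<Rightarrow> complex ^ 'n) \<Rightarrow> (complex, 'n) phase set \<Rightarrow> bool" where
  "canalytic_vec_on f S \<longleftrightarrow> (\<forall>i. canalytic_on (\<lambda>p. f p $ i) S)"

definition ranalytic_on :: "((real, 'n::finite) phase \<Rightarrow> real) \<Rightarrow> (real, 'n) phase set \<Rightarrow> bool" where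
  "ranalytic_on f S \<longleftrightarrow> (\<exists>F. canalytic_on F (cphase ` S) \<and> (\<forall>p\<in>S. F (cphase p) = complex_of_real (f p)))"

definition ranalytic_vec_on :: "((real, 'n::finite) phase \<Rightarrow> real ^ 'n) \<Rightarrow> (real, 'n) phase set \<Rightarrow> bool" where
  "ranalytic_vec_on f S \<longleftrightarrow> (\<forall>i. ranalytic_on (\<lambda>p. f p $ i) S)"

text \<open>Used both for real functions and, with complex partial derivatives, for their extensions.\<close>

definition grad_y :: "(('a::real_normed_field, 'n::finite) phase \<Rightarrow> 'a) \<Rightarrow> ('a, 'n) phase \<Rightarrow> 'a ^ 'n" where
  "grad_y f p = (case p of (y, x, t) \<Rightarrow> (\<chi> i. deriv (\<lambda>s. f (y + axis i s, x, t)) 0))"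

definition grad_x :: "(('a::real_normed_field, 'n::finite) phase \<Rightarrow> 'a) \<Rightarrow> ('a, 'n) phase \<Rightarrow> 'a ^ 'n" where
  "grad_x f p = (case p of (y, x, t) \<Rightarrow> (\<chi> i. deriv (\<lambda>s. f (y, x + axis i s, t)) 0))"

section \<open>Fourier expansions, truncations and norms\<close>

definition mode_size :: "'n::finite mode \<Rightarrow> nat" where
  "mode_size km = (case km of (k, m) \<Rightarrow> nat ((\<Sum>i\<in>UNIV. \<bar>k $ i\<bar>) + \<bar>m\<bar>))"

definition torus_cell :: "((real ^ 'n) \<times> real) set" where
  "torus_cell = cbox (0, 0) ((\<chi> i. 2 * pi), 2 * pi)"

definition harmonic :: "'n::finite mode \<Rightarrow> complex ^ 'n \<Rightarrow> complex \<Rightarrow> complex" where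
  "harmonic km x t = (case km of (k, m) \<Rightarrow>
     exp (\<i> * ((\<Sum>i\<in>UNIV. of_int (k $ i) * x $ i) + of_int m * t)))"

definition fcoeff :: "((complex, 'n::finite) phase \<Rightarrow> complex) \<Rightarrow> 'n mode \<Rightarrow> complex ^ 'n \<Rightarrow> complex" where
  "fcoeff f km y = complex_of_real (1 / (2 * pi) ^ (CARD('n) + 1)) *
     integral torus_cell (\<lambda>(x, t). f (y, cvec x, complex_of_real t) *
       inverse (harmonic km (cvec x) (complex_of_real t)))"

text \<open>
  Holds automatically for periodic functions that are analytic on a domain \<open>cdom A r s\<close>.
\<close>

definition fourier_series_on :: "((complex, 'n::finite) phase \<Rightarrow> complex ^ 'n) \<Rightarrow> (complex, 'n) phase set \<Rightarrow> bool" where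
  "fourier_series_on v S \<longleftrightarrow> (\<forall>i. \<forall>(y, x, t)\<in>S.
     ((\<lambda>km. fcoeff (\<lambda>p. v p $ i) km y * harmonic km x t) has_sum (v (y, x, t) $ i)) UNIV)"

definition high_modes :: "nat \<Rightarrow> ((complex, 'n::finite) phase \<Rightarrow> complex) \<Rightarrow> (complex, 'n) phase \<Rightarrow> complex" where
  "high_modes K f p = (case p of (y, x, t) \<Rightarrow>
     (\<Sum>\<^sub>\<infinity>km\<in>{km. mode_size km > K}. fcoeff f km y * harmonic km x t))"

definition high_modes_vec :: "nat \<Rightarrow> ((complex, 'n::finite) phase \<Rightarrow> complex ^ 'n) \<Rightarrow> (complex, 'n) phase \<Rightarrow> complex ^ 'n" where
  "high_modes_vec K v p = (\<chi> i. high_modes K (\<lambda>q. v q $ i) p)"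

text \<open>Norms are extended nonnegative reals, so that an unbounded function has norm \<open>\<infinity>\<close>.\<close>

definition fnorm :: "(real ^ 'n) set \<Rightarrow> real \<Rightarrow> real \<Rightarrow> ((complex, 'n::finite) phase \<Rightarrow> complex) \<Rightarrow> ennreal" where
  "fnorm A r s f = (SUP y\<in>C_act r A.
     (\<Sum>\<^sub>\<infinity>km\<in>UNIV. ennreal (norm (fcoeff f km y) * exp (real (mode_size km) * s))))"

definition fnorm_vec :: "(real ^ 'n) set \<Rightarrow> real \<Rightarrow> real \<Rightarrow> ((complex, 'n::finite) phase \<Rightarrow> complex ^ 'n) \<Rightarrow> ennreal" where
  "fnorm_vec A r s v = (if \<exists>j. fnorm A r s (\<lambda>p. v p $ j) = \<infinity> then \<infinity>
     else ennreal (sqrt (\<Sum>j\<in>UNIV. (enn2real (fnorm A r s (\<lambda>p. v p $ j)))\<^sup>2)))"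

definition sup_norm :: "(real ^ 'n) set \<Rightarrow> real \<Rightarrow> (complex ^ 'n \<Rightarrow> complex ^ 'n) \<Rightarrow> ennreal" where
  "sup_norm A r g = (SUP y\<in>C_act r A. ennreal (norm (g y)))"

section \<open>The vector field\<close>

text \<open>
  The fields hold the complex extensions; only their values on the complex domain matter.
  \<open>ham\<close>, \<open>fpert\<close>, \<open>gpert\<close> are \<open>h\<^sub>1\<^sub>0\<close>, \<open>f\<^sub>0\<^sub>1\<close>, \<open>g\<^sub>0\<^sub>1\<close>.
\<close>

record ('n::finite) system =
  act_dom :: "(real, 'n) vec set"
  freq :: "(complex, 'n) vec \<Rightarrow> (complex, 'n) vec"
  ham :: "(complex, 'n) phase \<Rightarrow> complex"
  fpert :: "(complex, 'n) phase \<Rightarrow> (complex, 'n) vec"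
  gpert :: "(complex, 'n) phase \<Rightarrow> (complex, 'n) vec"

definition analytic_system :: "'n::finite system \<Rightarrow> real \<Rightarrow> real \<Rightarrow> bool" where
  "analytic_system S r0 s0 \<longleftrightarrow>
     open (act_dom S) \<and>
     canalytic_vec_on (\<lambda>(y, x, t). freq S y) (cdom (act_dom S) r0 s0) \<and>
     canalytic_on (ham S) (cdom (act_dom S) r0 s0) \<and>
     canalytic_vec_on (fpert S) (cdom (act_dom S) r0 s0) \<and>
     canalytic_vec_on (gpert S) (cdom (act_dom S) r0 s0) \<and>
     periodic_on (ham S) (cdom (act_dom S) r0 s0) \<and>
     periodic_on (fpert S) (cdom (act_dom S) r0 s0) \<and>
     periodic_on (gpert S) (cdom (act_dom S) r0 s0) \<and>
     (\<forall>y\<in>act_dom S. \<forall>i. freq S (cvec y) $ i \<in> \<real>) \<and>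
     (\<forall>p\<in>rdom (act_dom S). ham S (cphase p) \<in> \<real> \<and>
        (\<forall>i. fpert S (cphase p) $ i \<in> \<real> \<and> gpert S (cphase p) $ i \<in> \<real>)) \<and>
     (\<exists>h00. ranalytic_on (\<lambda>(y, x, t). h00 y) (rdom (act_dom S)) \<and>
        (\<forall>y\<in>act_dom S. re_vec (freq S (cvec y)) = grad_y (\<lambda>(y, x, t). h00 y) (y, 0, 0)))"

type_synonym 'n drift = "real \<Rightarrow> real \<Rightarrow> (real, 'n) phase \<Rightarrow> (real, 'n) vec"

definition vf_x :: "'n::finite system \<Rightarrow> real \<Rightarrow> real \<Rightarrow> (real, 'n) phase \<Rightarrow> real ^ 'n" where
  "vf_x S \<epsilon> \<mu> p = re_vec (freq S (cvec (fst p))) + \<epsilon> *\<^sub>R re_vec (grad_y (ham S) (cphase p))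
     + \<mu> *\<^sub>R re_vec (fpert S (cphase p))"

definition vf_y :: "'n::finite system \<Rightarrow> 'n drift \<Rightarrow> real \<Rightarrow> real \<Rightarrow> (real, 'n) phase \<Rightarrow> real ^ 'n" where
  "vf_y S \<eta> \<epsilon> \<mu> p = - (\<epsilon> *\<^sub>R re_vec (grad_x (ham S) (cphase p)))
     + \<mu> *\<^sub>R (re_vec (gpert S (cphase p)) - \<eta> \<epsilon> \<mu> p)"

definition is_solution :: "'n::finite system \<Rightarrow> 'n drift \<Rightarrow> real \<Rightarrow> real \<Rightarrow> real
    \<Rightarrow> (real \<Rightarrow> real ^ 'n) \<Rightarrow> (real \<Rightarrow> real ^ 'n) \<Rightarrow> bool" where
  "is_solution S \<eta> \<epsilon> \<mu> T y x \<longleftrightarrow> (\<forall>t\<in>{0..T}. y t \<in> act_dom S \<and>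
     (y has_vector_derivative vf_y S \<eta> \<epsilon> \<mu> (y t, x t, t)) (at t within {0..T}) \<and>
     (x has_vector_derivative vf_x S \<epsilon> \<mu> (y t, x t, t)) (at t within {0..T}))"

text \<open>The mode \<open>(0, 0)\<close> has to be left out: for it the left-hand side vanishes.\<close>

definition nonresonant_on :: "'n::finite system \<Rightarrow> (real ^ 'n) set \<Rightarrow> nat \<Rightarrow> real \<Rightarrow> bool" where
  "nonresonant_on S D K a \<longleftrightarrow> (\<forall>y\<in>D. \<forall>k m. (k, m) \<noteq> (0, 0) \<and> mode_size (k, m) \<le> K \<longrightarrow>
     a \<le> \<bar>(\<Sum>i\<in>UNIV. re_vec (freq S (cvec y)) $ i * real_of_int (k $ i)) + real_of_int m\<bar>)"

section \<open>The Normal Form Lemma\<close>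

definition admissible :: "real \<Rightarrow> real \<Rightarrow> real \<Rightarrow> real \<Rightarrow> bool" where
  "admissible \<epsilon>0 \<mu>0 \<epsilon> \<mu> \<longleftrightarrow> 0 \<le> \<epsilon> \<and> \<epsilon> \<le> \<epsilon>0 \<and> \<mu> \<noteq> 0 \<and> \<bar>\<mu>\<bar> \<le> \<mu>0"

definition lam :: "real \<Rightarrow> real \<Rightarrow> real" where
  "lam \<epsilon> \<mu> = max \<epsilon> \<bar>\<mu>\<bar>"

definition normal_order :: "nat \<Rightarrow> real \<Rightarrow> real \<Rightarrow> real \<Rightarrow> nat" where
  "normal_order K \<tau> \<epsilon> \<mu> = nat \<lfloor>real K * \<tau> / \<bar>ln (lam \<epsilon> \<mu>)\<bar>\<rfloor>"

definition drift_function :: "(real ^ 'n) set \<Rightarrow> real \<Rightarrow> real \<Rightarrow> 'n::finite drift \<Rightarrow> bool" where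
  "drift_function A \<epsilon>0 \<mu>0 \<eta> \<longleftrightarrow>
     (\<forall>\<epsilon> \<mu>. admissible \<epsilon>0 \<mu>0 \<epsilon> \<mu> \<longrightarrow>
        ranalytic_vec_on (\<eta> \<epsilon> \<mu>) (rdom A) \<and> periodic_on (\<eta> \<epsilon> \<mu>) (rdom A)) \<and>
     (\<exists>c :: nat \<Rightarrow> nat \<Rightarrow> (real, 'n) phase \<Rightarrow> real ^ 'n. \<forall>\<epsilon> \<mu>. admissible \<epsilon>0 \<mu>0 \<epsilon> \<mu> \<longrightarrow> (\<forall>p\<in>rdom A.
        (\<lambda>m. \<Sum>j\<le>m. (\<epsilon> ^ j * \<mu> ^ (m - j)) *\<^sub>R c j (m - j + 1) p) sums \<eta> \<epsilon> \<mu> p))"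

text \<open>\<open>F \<in> O\<^sub>k(\<epsilon>, \<mu>)\<close>, for a family \<open>F\<close> over the parameter set \<open>P\<close> of functions on \<open>S\<close>.\<close>

definition order_at_least :: "nat \<Rightarrow> (real \<times> real) set \<Rightarrow> 'p set \<Rightarrow>
    (real \<Rightarrow> real \<Rightarrow> 'p \<Rightarrow> complex ^ 'n) \<Rightarrow> bool" where
  "order_at_least k P S F \<longleftrightarrow> (\<exists>c :: nat \<Rightarrow> nat \<Rightarrow> 'p \<Rightarrow> complex ^ 'n. \<forall>(\<epsilon>, \<mu>)\<in>P. \<forall>p\<in>S.
     ((\<lambda>(j, m). (\<epsilon> ^ j * \<mu> ^ m) *\<^sub>R c j m p) has_sum F \<epsilon> \<mu> p) {(j, m). k \<le> j + m})"

definition poly_sum :: "nat \<Rightarrow> (nat \<Rightarrow> nat \<Rightarrow> 'p \<Rightarrow> 'v::real_vector) \<Rightarrow> real \<Rightarrow> real \<Rightarrow> 'p \<Rightarrow> 'v" where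
  "poly_sum N c \<epsilon> \<mu> p = (\<Sum>m=0..N. \<Sum>j=0..m. (\<epsilon> ^ j * \<mu> ^ (m - j)) *\<^sub>R c j (m - j) p)"

text \<open>
  \<open>\<Xi>c\<close> is the map implicitly defined by the generating functions \<open>\<psi> j\<close>; the new actions take values
  in \<open>B\<close>, on which \<open>\<psi>\<close> (and the coefficients of the second transformation) are defined.
\<close>

definition is_Xi_c :: "(real ^ 'n) set \<Rightarrow> (real ^ 'n) set \<Rightarrow> nat \<Rightarrow> (nat \<Rightarrow> (real, 'n) phase \<Rightarrow> real)
    \<Rightarrow> real \<Rightarrow> ((real, 'n::finite) phase \<Rightarrow> (real, 'n) phase) \<Rightarrow> bool" where
  "is_Xi_c A B N \<psi> \<epsilon> \<Xi>c \<longleftrightarrow> (\<forall>y\<in>A. \<forall>x t. \<exists>y'\<in>B. \<exists>x'.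
       \<Xi>c (y, x, t) = (y', x', t) \<and>
       x' = x + (\<Sum>j=1..N. \<epsilon> ^ j *\<^sub>R grad_y (\<psi> j) (y', x, t)) \<and>
       y = y' + (\<Sum>j=1..N. \<epsilon> ^ j *\<^sub>R grad_x (\<psi> j) (y', x, t))) \<and>
     (\<forall>p\<in>rdom A. \<forall>km. \<Xi>c (shift km p) = shift km (\<Xi>c p))"

definition Xi_d :: "nat \<Rightarrow> (nat \<Rightarrow> nat \<Rightarrow> (real, 'n) phase \<Rightarrow> real ^ 'n)
    \<Rightarrow> (nat \<Rightarrow> nat \<Rightarrow> (real, 'n) phase \<Rightarrow> real ^ 'n)
    \<Rightarrow> real \<Rightarrow> real \<Rightarrow> (real, 'n::finite) phase \<Rightarrow> (real, 'n) phase" where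
  "Xi_d N \<alpha> \<beta> \<epsilon> \<mu> p = (case p of (y, x, t) \<Rightarrow>
     (y + poly_sum N \<beta> \<epsilon> \<mu> p, x + poly_sum N \<alpha> \<epsilon> \<mu> p, t))"

definition d_coefficients :: "(real ^ 'n) set \<Rightarrow> (nat \<Rightarrow> nat \<Rightarrow> (real, 'n::finite) phase \<Rightarrow> real ^ 'n) \<Rightarrow> bool" where
  "d_coefficients B \<alpha> \<longleftrightarrow>
     (\<forall>i j. ranalytic_vec_on (\<alpha> i j) (rdom B) \<and> periodic_on (\<alpha> i j) (rdom B)) \<and>
     (\<forall>i. \<forall>p\<in>rdom B. \<alpha> i 0 p = 0) \<and>
     (\<forall>i j. \<forall>y\<in>B. integral torus_cell (\<lambda>(x, t). \<alpha> i j (y, x, t)) = 0)"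

definition Omega_d :: "'n::finite system \<Rightarrow> nat \<Rightarrow> (nat \<Rightarrow> nat \<Rightarrow> complex ^ 'n \<Rightarrow> complex ^ 'n)
    \<Rightarrow> real \<Rightarrow> real \<Rightarrow> complex ^ 'n \<Rightarrow> complex ^ 'n" where
  "Omega_d S N \<Omega> \<epsilon> \<mu> Y = freq S Y + poly_sum N \<Omega> \<epsilon> \<mu> Y"

text \<open>
  The new vector field at \<open>q = (Y, X, t)\<close>; \<open>\<Xi>inv q\<close> is \<open>(y(Y,X,t), x(Y,X,t), t)\<close>. Its values are
  complex vectors; \<open>brings_into_normal_form\<close> equates them with (embedded) real ones.
\<close>

definition nf_x :: "'n::finite system \<Rightarrow> nat \<Rightarrow> real \<Rightarrow> real \<Rightarrow> (complex ^ 'n \<Rightarrow> complex ^ 'n)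
    \<Rightarrow> ((complex, 'n) phase \<Rightarrow> complex ^ 'n) \<Rightarrow> ((complex, 'n) phase \<Rightarrow> complex ^ 'n)
    \<Rightarrow> ((real, 'n) phase \<Rightarrow> (real, 'n) phase) \<Rightarrow> (real, 'n) phase \<Rightarrow> complex ^ 'n" where
  "nf_x S K \<epsilon> \<mu> \<Omega>d F F01 \<Xi>inv q = \<Omega>d (cvec (fst q)) + F (cphase q) + high_modes_vec K F01 (cphase q)
     + \<epsilon> *\<^sub>R high_modes_vec K (grad_y (ham S)) (cphase (\<Xi>inv q))
     + \<mu> *\<^sub>R high_modes_vec K (fpert S) (cphase (\<Xi>inv q))"

definition nf_y :: "'n::finite system \<Rightarrow> nat \<Rightarrow> real \<Rightarrow> real
    \<Rightarrow> ((complex, 'n) phase \<Rightarrow> complex ^ 'n) \<Rightarrow> ((complex, 'n) phase \<Rightarrow> complex ^ 'n)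
    \<Rightarrow> ((real, 'n) phase \<Rightarrow> (real, 'n) phase) \<Rightarrow> (real, 'n) phase \<Rightarrow> complex ^ 'n" where
  "nf_y S K \<epsilon> \<mu> G G01 \<Xi>inv q = G (cphase q) + high_modes_vec K G01 (cphase q)
     - \<epsilon> *\<^sub>R high_modes_vec K (grad_x (ham S)) (cphase (\<Xi>inv q))
     + \<mu> *\<^sub>R high_modes_vec K (gpert S) (cphase (\<Xi>inv q))"

text \<open>
  The differential of \<open>\<Xi>\<close> maps the original field (with \<open>dt/dt = 1\<close>) to the new one.
\<close>

definition brings_into_normal_form :: "'n::finite system \<Rightarrow> 'n drift \<Rightarrow> nat \<Rightarrow> real \<Rightarrow> real
    \<Rightarrow> ((real, 'n) phase \<Rightarrow> (real, 'n) phase) \<Rightarrow> (complex ^ 'n \<Rightarrow> complex ^ 'n)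
    \<Rightarrow> ((complex, 'n) phase \<Rightarrow> complex ^ 'n) \<Rightarrow> ((complex, 'n) phase \<Rightarrow> complex ^ 'n)
    \<Rightarrow> ((complex, 'n) phase \<Rightarrow> complex ^ 'n) \<Rightarrow> ((complex, 'n) phase \<Rightarrow> complex ^ 'n) \<Rightarrow> bool" where
  "brings_into_normal_form S \<eta> K \<epsilon> \<mu> \<Xi> \<Omega>d F F01 G G01 \<longleftrightarrow>
     inj_on \<Xi> (rdom (act_dom S)) \<and>
     (\<forall>p\<in>rdom (act_dom S). \<exists>D. (\<Xi> has_derivative D) (at p) \<and>
        (\<exists>Y' X'. D (vf_y S \<eta> \<epsilon> \<mu> p, vf_x S \<epsilon> \<mu> p, 1) = (Y', X', 1) \<and>
           cvec X' = nf_x S K \<epsilon> \<mu> \<Omega>d F F01 (inv_into (rdom (act_dom S)) \<Xi>) (\<Xi> p) \<and>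
           cvec Y' = nf_y S K \<epsilon> \<mu> G G01 (inv_into (rdom (act_dom S)) \<Xi>) (\<Xi> p)))"

text \<open>
  The Normal Form Lemma at order \<open>N\<close>, for the parameters \<open>P\<close> at which this order is used.
  The functions \<open>F\<close> and \<open>G\<close> are \<open>F\<^bsub>N+1\<^esub>\<close> and \<open>G\<^bsub>N+1\<^esub>\<close>. That \<open>\<Xi>\<close> maps into the domains with
  radii \<open>R0\<close> and \<open>r1\<close> is what makes the right-hand sides of the new field meaningful.
\<close>

definition normal_form_order :: "'n::finite system \<Rightarrow> 'n drift \<Rightarrow> real \<Rightarrow> real \<Rightarrow> nat \<Rightarrow> real
    \<Rightarrow> (real \<times> real) set \<Rightarrow> nat \<Rightarrow> real \<Rightarrow> real \<Rightarrow> real \<Rightarrow> bool" where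
  "normal_form_order S \<eta> r0 s0 K \<tau> P N C\<omega> CY Cp \<longleftrightarrow>
   (\<exists>B \<psi> \<alpha> \<beta> \<Omega> \<Xi>c F F01 G G01 R0 S0 r1.
      0 < R0 \<and> R0 < r0 \<and> 0 < S0 \<and> S0 < s0 \<and> 0 < r1 \<and> r1 < r0 \<and>
      open B \<and>
      (\<forall>j. ranalytic_on (\<psi> j) (rdom B) \<and> periodic_on (\<psi> j) (rdom B)) \<and>
      d_coefficients B \<alpha> \<and> d_coefficients B \<beta> \<and>
      (\<forall>i j. canalytic_vec_on (\<lambda>(y, x, t). \<Omega> i j y) (cdom (act_dom S) r1 s0)) \<and>
      (\<forall>Y\<in>C_act r1 (act_dom S). \<Omega> 0 0 Y = 0) \<and>
      order_at_least (N + 1) P (cdom (act_dom S) R0 S0) F \<and>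
      order_at_least (N + 1) P (cdom (act_dom S) R0 S0) G \<and>
      order_at_least 1 P (cdom (act_dom S) R0 S0) (\<lambda>\<epsilon> \<mu>. high_modes_vec K (F01 \<epsilon> \<mu>)) \<and>
      order_at_least 1 P (cdom (act_dom S) R0 S0) (\<lambda>\<epsilon> \<mu>. high_modes_vec K (G01 \<epsilon> \<mu>)) \<and>
      (\<forall>(\<epsilon>, \<mu>)\<in>P.
         (\<forall>H\<in>{F \<epsilon> \<mu>, G \<epsilon> \<mu>, F01 \<epsilon> \<mu>, G01 \<epsilon> \<mu>}.
            canalytic_vec_on H (cdom (act_dom S) R0 S0) \<and> periodic_on H (cdom (act_dom S) R0 S0) \<and>
            fourier_series_on H (cdom (act_dom S) R0 S0)) \<and>
         is_Xi_c (act_dom S) B N \<psi> \<epsilon> (\<Xi>c \<epsilon> \<mu>) \<and>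
         (let \<Xi> = Xi_d N \<alpha> \<beta> \<epsilon> \<mu> \<circ> \<Xi>c \<epsilon> \<mu>; \<Omega>d = Omega_d S N \<Omega> \<epsilon> \<mu>; L = lam \<epsilon> \<mu>;
              bound = fnorm_vec (act_dom S) R0 S0 (G \<epsilon> \<mu>)
                + fnorm_vec (act_dom S) R0 S0 (high_modes_vec K (G01 \<epsilon> \<mu>))
                + ennreal \<epsilon> * fnorm_vec (act_dom S) R0 S0 (high_modes_vec K (grad_x (ham S)))
                + ennreal \<bar>\<mu>\<bar> * fnorm_vec (act_dom S) R0 S0 (high_modes_vec K (gpert S))
          in
            (\<forall>p\<in>rdom (act_dom S). cphase (\<Xi> p) \<in> cdom (act_dom S) R0 S0 \<and> cvec (fst (\<Xi> p)) \<in> C_act r1 (act_dom S)) \<and>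
            brings_into_normal_form S \<eta> K \<epsilon> \<mu> \<Xi> \<Omega>d (F \<epsilon> \<mu>) (F01 \<epsilon> \<mu>) (G \<epsilon> \<mu>) (G01 \<epsilon> \<mu>) \<and>
            sup_norm (act_dom S) r1 (\<lambda>Y. \<Omega>d Y - freq S Y) \<le> ennreal (C\<omega> * L) \<and>
            bound \<le> ennreal (CY * L ^ (N + 1)) \<and>
            bound \<le> ennreal (CY * L * exp (- (real K * \<tau>))) \<and>
            (\<forall>p\<in>rdom (act_dom S). norm (fst (\<Xi> p) - fst p) \<le> Cp * L))))"

text \<open>
  The constants are functions of the order \<open>N = [K\<tau>/\<bar>log \<lambda>\<bar>]\<close>, which varies with the parameters.
\<close>

definition normal_form_lemma :: "'n::finite system \<Rightarrow> 'n drift \<Rightarrow> real \<Rightarrow> real \<Rightarrow> nat \<Rightarrow> real \<Rightarrow> real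
    \<Rightarrow> (nat \<Rightarrow> real) \<Rightarrow> (nat \<Rightarrow> real) \<Rightarrow> (nat \<Rightarrow> real) \<Rightarrow> real \<Rightarrow> bool" where
  "normal_form_lemma S \<eta> r0 s0 K \<epsilon>0 \<mu>0 C\<omega> CY Cp \<tau> \<longleftrightarrow>
     drift_function (act_dom S) \<epsilon>0 \<mu>0 \<eta> \<and>
     (\<forall>N. normal_form_order S \<eta> r0 s0 K \<tau>
        {(\<epsilon>, \<mu>). admissible \<epsilon>0 \<mu>0 \<epsilon> \<mu> \<and> normal_order K \<tau> \<epsilon> \<mu> = N} N (C\<omega> N) (CY N) (Cp N))"

end

(* In the normal form coordinates the action component moves with speed at most
   CY * lambda * exp (-K tau), since a function is pointwise bounded on real angles by its weighted
   Fourier norm. Over a time exp (K tau) it therefore moves by at most CY * lambda, and the coordinate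
   change displaces the action by at most Cp * lambda at each of the two endpoints.

   The norm of a truncation f^{>K} is computed from the Fourier coefficients of f^{>K} itself, so the
   pointwise bound needs them to be the high coefficients of f: this is orthogonality of characters. *)

theory Submission
  imports Defs
begin

section \<open>Orthogonality of characters on a cube of side \<open>2 * pi\<close>\<close>

lemma lebesgue_integral_character_period:
  fixes n :: int
  shows "set_integrable lborel {0..2 * pi} (\<lambda>s. exp (\<i> * of_real (of_int n * s)))"
    and "(LBINT s:{0..2 * pi}. exp (\<i> * of_real (of_int n * s))) = (if n = 0 then of_real (2 * pi) else 0)"
proof -
  show int: "set_integrable lborel {0..2 * pi} (\<lambda>s. exp (\<i> * of_real (of_int n * s)))"
    by (intro borel_integrable_atLeastAtMost' continuous_intros)
  \<comment> \<open>The value comes from an antiderivative and hence from the gauge integral; it is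
    carried over to the Lebesgue integral because the product formula for several variables is
    stated there.\<close>
  have "((\<lambda>s. exp (\<i> * of_real (of_int n * s))) has_integral (if n = 0 then of_real (2 * pi) else 0)) {0..2 * pi}"
  proof (cases "n = 0")
    case True
    then show ?thesis
      using has_integral_const_real[of "1 :: complex" 0 "2 * pi"] by (simp add: scaleR_conv_of_real)
  next
    case False
    have i_i: "\<i> * (z * \<i>) = - z" for z by (simp add: mult.commute)
    let ?E = "\<lambda>s. exp (\<i> * of_real (of_int n * s)) / (\<i> * of_int n)"
    have "((\<lambda>s. exp (\<i> * of_real (of_int n * s))) has_integral (?E (2 * pi) - ?E 0)) {0..2 * pi}"
    proof (rule fundamental_theorem_of_calculus)
      fix s :: real
      show "(?E has_vector_derivative exp (\<i> * of_real (of_int n * s))) (at s within {0..2 * pi})"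
        using False by (auto intro!: derivative_eq_intros has_vector_derivative_real_field simp: i_i)
    qed simp
    moreover have "exp (\<i> * of_real (of_int n * (2 * pi))) = 1"
      by (subst exp_eq_1) (auto intro!: exI[of _ n])
    ultimately show ?thesis using False by simp
  qed
  then show "(LBINT s:{0..2 * pi}. exp (\<i> * of_real (of_int n * s))) = (if n = 0 then of_real (2 * pi) else 0)"
    using set_borel_integral_eq_integral(2)[OF int] by (simp add: integral_unique)
qed

text \<open>A character is a product of one-variable characters, and the cube is a product of
  intervals, so the integral is a product of integrals over one period. Integrality of the
  coordinates of \<open>\<kappa>\<close> makes a factor vanish as soon as one coordinate is
  nonzero.\<close>

lemma has_integral_character_cube:
  fixes \<kappa> :: "'a::euclidean_space"
  assumes "\<And>b. b \<in> Basis \<Longrightarrow> \<kappa> \<bullet> b \<in> \<int>"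
  shows "((\<lambda>z. exp (\<i> * of_real (\<kappa> \<bullet> z))) has_integral
    (if \<kappa> = 0 then of_real ((2 * pi) ^ DIM('a)) else 0)) (cbox 0 ((2 * pi) *\<^sub>R One))"
proof -
  let ?C = "cbox 0 ((2 * pi) *\<^sub>R One) :: 'a set"
  \<comment> \<open>The indicator of one period is built into each factor: the product over
    coordinates then carries the indicator of the cube, and all integrals run over whole
    spaces.\<close>
  define g :: "'a \<Rightarrow> real \<Rightarrow> complex" where
    "g = (\<lambda>b s. indicator {0..2 * pi} s *\<^sub>R exp (\<i> * of_real ((\<kappa> \<bullet> b) * s)))"
  interpret product_sigma_finite "\<lambda>b :: 'a. lborel :: real measure" by standard
  have g: "integrable lborel (g b) \<and> integral\<^sup>L lborel (g b) = (if \<kappa> \<bullet> b = 0 then of_real (2 * pi) else 0)"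
    if b: "b \<in> Basis" for b
  proof -
    obtain n where "\<kappa> \<bullet> b = of_int n" using assms[OF b] by (auto elim: Ints_cases)
    then show ?thesis
      using lebesgue_integral_character_period[of n]
      by (simp add: g_def set_integrable_def set_lebesgue_integral_def)
  qed
  have prod_eq: "indicator ?C z *\<^sub>R exp (\<i> * of_real (\<kappa> \<bullet> z)) = (\<Prod>b\<in>Basis. g b (z \<bullet> b))" for z
  proof -
    have "(\<Prod>b\<in>Basis. g b (z \<bullet> b)) = of_real (\<Prod>b\<in>Basis. indicator {0..2 * pi} (z \<bullet> b)) *
        (\<Prod>b\<in>Basis. exp (\<i> * of_real ((\<kappa> \<bullet> b) * (z \<bullet> b))))"
      by (simp add: g_def scaleR_conv_of_real prod.distrib)
    also have "(\<Prod>b\<in>Basis. exp (\<i> * of_real ((\<kappa> \<bullet> b) * (z \<bullet> b)))) = exp (\<i> * of_real (\<kappa> \<bullet> z))"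
      by (simp add: euclidean_inner[of \<kappa> z] exp_sum sum_distrib_left)
    also have "(\<Prod>b\<in>Basis. indicator {0..2 * pi} (z \<bullet> b)) = (indicator ?C z :: real)"
    proof (cases "z \<in> ?C")
      case True
      then show ?thesis by (auto simp: mem_box intro!: prod.neutral)
    next
      case False
      then obtain b where "b \<in> Basis" "z \<bullet> b \<notin> {0..2 * pi}" by (auto simp: mem_box)
      then show ?thesis using False by (auto simp: intro!: prod_zero bexI[of _ b])
    qed
    finally show ?thesis by (simp add: scaleR_conv_of_real)
  qed
  have int: "set_integrable lborel ?C (\<lambda>z. exp (\<i> * of_real (\<kappa> \<bullet> z)))"
    unfolding set_integrable_def
    by (intro borel_integrable_compact compact_cbox continuous_intros)
  then have meas: "(\<lambda>z. indicator ?C z *\<^sub>R exp (\<i> * of_real (\<kappa> \<bullet> z))) \<in> borel_measurable borel"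
    unfolding set_integrable_def by (simp add: borel_measurable_integrable flip: measurable_lborel1)
  have proj: "(\<lambda>f. \<Sum>b\<in>Basis. f b *\<^sub>R b) \<in> measurable (\<Pi>\<^sub>M b\<in>Basis. lborel) (borel :: 'a measure)"
    by (intro borel_measurable_sum borel_measurable_scaleR) simp_all
  \<comment> \<open>Lebesgue measure is the image of the product of one-dimensional measures under
    the map assembling a vector from its coordinates; the integral is pulled back along it.\<close>
  have "(LBINT z:?C. exp (\<i> * of_real (\<kappa> \<bullet> z))) =
      (\<integral>x. (\<Prod>b\<in>Basis. g b ((\<Sum>b\<in>Basis. x b *\<^sub>R b) \<bullet> b)) \<partial>Pi\<^sub>M Basis (\<lambda>b. lborel))"
    unfolding set_lebesgue_integral_def
    by (subst lborel_eq, subst integral_distr[OF proj meas]) (simp only: prod_eq)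
  also have "\<dots> = (\<integral>x. (\<Prod>b\<in>Basis. g b (x b)) \<partial>Pi\<^sub>M Basis (\<lambda>b. lborel))"
    by (intro Bochner_Integration.integral_cong refl prod.cong) simp_all
  also have "\<dots> = (\<Prod>b\<in>Basis. integral\<^sup>L lborel (g b))"
    using g by (intro product_integral_prod) auto
  also have "\<dots> = (\<Prod>b\<in>Basis. if \<kappa> \<bullet> b = 0 then of_real (2 * pi) else 0)"
    using g by (intro prod.cong) auto
  also have "\<dots> = (if \<kappa> = 0 then of_real ((2 * pi) ^ DIM('a)) else 0)"
  proof (cases "\<kappa> = 0")
    case False
    then obtain b where "b \<in> Basis" "\<kappa> \<bullet> b \<noteq> 0" using euclidean_all_zero_iff[of \<kappa>] by blast
    then show ?thesis using False by (auto intro!: prod_zero)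
  qed simp
  finally show ?thesis
    using set_borel_integral_eq_integral[OF int] by (auto simp: has_integral_iff)
qed

section \<open>Harmonics and Fourier coefficients on the torus cell\<close>

definition wave_vector :: "'n::finite mode \<Rightarrow> (real ^ 'n) \<times> real" where
  "wave_vector km = ((\<chi> i. of_int (fst km $ i)), of_int (snd km))"

text \<open>At real angles the phase is a real inner product. So harmonics have modulus one there,
  which drives the summability arguments, and they are characters in the sense of the cube
  lemma.\<close>

lemma harmonic_real:
  "harmonic km (cvec x) (complex_of_real t) = exp (\<i> * of_real (wave_vector km \<bullet> (x, t)))"
  by (cases km) (simp add: harmonic_def wave_vector_def cvec_def inner_vec_def)

lemma wave_vector_diff_Ints:
  assumes "b \<in> Basis"
  shows "(wave_vector km - wave_vector km') \<bullet> b \<in> \<int>"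
  using assms by (auto simp: wave_vector_def Basis_prod_def Basis_vec_def inner_axis)

lemma wave_vector_eq_iff: "wave_vector km = wave_vector km' \<longleftrightarrow> km = km'"
  by (cases km; cases km') (auto simp: wave_vector_def vec_eq_iff)

lemma torus_cell_eq: "(torus_cell :: ((real ^ 'n::finite) \<times> real) set) = cbox 0 ((2 * pi) *\<^sub>R One)"
proof -
  have "((\<chi> i. 2 * pi), 2 * pi) = ((2 * pi) *\<^sub>R One :: (real ^ 'n) \<times> real)"
  proof (rule euclidean_eqI)
    fix b :: "(real ^ 'n) \<times> real" assume "b \<in> Basis"
    then have "((\<chi> i. 2 * pi), 2 * pi) \<bullet> b = 2 * pi"
      by (auto simp: Basis_prod_def Basis_vec_def inner_axis)
    then show "((\<chi> i. 2 * pi), 2 * pi) \<bullet> b = (2 * pi) *\<^sub>R One \<bullet> b"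
      using \<open>b \<in> Basis\<close> by simp
  qed
  then show ?thesis by (simp only: torus_cell_def zero_prod_def)
qed

text \<open>The quotient is the character of the difference of the wave vectors, which is integral
  and vanishes only for equal modes. The \<open>inverse\<close> matches the integrand of
  \<open>fcoeff\<close>.\<close>

lemma has_integral_harmonic_orthogonal:
  "((\<lambda>z. exp (\<i> * of_real (wave_vector km \<bullet> z)) * inverse (exp (\<i> * of_real (wave_vector km' \<bullet> z))))
     has_integral (if km = km' then of_real ((2 * pi) ^ (CARD('n) + 1)) else 0))
     (torus_cell :: ((real ^ 'n::finite) \<times> real) set)"
proof -
  let ?\<kappa> = "wave_vector km - wave_vector km'"
  have eq: "exp (\<i> * of_real (wave_vector km \<bullet> z)) * inverse (exp (\<i> * of_real (wave_vector km' \<bullet> z))) =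
      exp (\<i> * of_real (?\<kappa> \<bullet> z))" for z
    by (simp add: inner_diff_left right_diff_distrib exp_diff divide_inverse)
  have "?\<kappa> = 0 \<longleftrightarrow> km = km'" by (simp add: wave_vector_eq_iff)
  moreover have "DIM((real ^ 'n) \<times> real) = CARD('n) + 1" by simp
  ultimately show ?thesis
    unfolding eq torus_cell_eq using has_integral_character_cube[OF wave_vector_diff_Ints[of _ km km']]
    by (simp only:)
qed

text \<open>Absolute summability of the coefficients gives uniform convergence at real angles, the
  only ones that \<open>fcoeff\<close> samples. The series may thus be integrated term by term, and
  orthogonality leaves at most one term.\<close>

lemma fcoeff_infsum_harmonics:
  fixes c :: "'n::finite mode \<Rightarrow> complex"
  assumes "(\<lambda>km. norm (c km)) summable_on M"
    and f: "\<And>x t. f (y, cvec x, complex_of_real t) =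
      (\<Sum>\<^sub>\<infinity>km\<in>M. c km * harmonic km (cvec x) (complex_of_real t))"
  shows "fcoeff f km y = (if km \<in> M then c km else 0)"
proof -
  let ?e = "\<lambda>km z. exp (\<i> * of_real (wave_vector km \<bullet> z))"
  let ?V = "complex_of_real ((2 * pi) ^ (CARD('n) + 1))"
  have "uniform_limit torus_cell (\<lambda>X z. \<Sum>l\<in>X. c l * ?e l z * inverse (?e km z))
      (\<lambda>z. \<Sum>\<^sub>\<infinity>l\<in>M. c l * ?e l z * inverse (?e km z)) (finite_subsets_at_top M)"
    by (rule Weierstrass_m_test_general[where M = "\<lambda>l. norm (c l)"])
      (use assms(1) in \<open>simp_all add: norm_mult norm_inverse\<close>)
  then obtain I J where I: "\<And>X. ((\<lambda>z. \<Sum>l\<in>X. c l * ?e l z * inverse (?e km z)) has_integral I X) torus_cell"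
    and J: "((\<lambda>z. \<Sum>\<^sub>\<infinity>l\<in>M. c l * ?e l z * inverse (?e km z)) has_integral J) torus_cell"
    and lim: "(I \<longlongrightarrow> J) (finite_subsets_at_top M)"
    unfolding torus_cell_def
    by (rule uniform_limit_integral_cbox) (auto intro!: continuous_intros)
  have I_eq: "I X = (if km \<in> X then c km * ?V else 0)" if "finite X" for X
  proof -
    have "((\<lambda>z. \<Sum>l\<in>X. c l * (?e l z * inverse (?e km z))) has_integral
        (\<Sum>l\<in>X. c l * (if l = km then ?V else 0))) torus_cell"
      using that by (intro has_integral_sum has_integral_mult_right has_integral_harmonic_orthogonal)
    then have "I X = (\<Sum>l\<in>X. c l * (if l = km then ?V else 0))"
      using I[of X] by (simp add: mult.assoc has_integral_unique)
    then show ?thesis using that by (simp add: if_distrib[of "\<lambda>u. c _ * u"] sum.delta cong: if_cong)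
  qed
  \<comment> \<open>The set \<open>{km} \<inter> M\<close> serves both cases: beyond it
    \<open>X\<close> contains \<open>km\<close> if \<open>km\<close> lies in \<open>M\<close>, and
    otherwise no subset of \<open>M\<close> does.\<close>
  have "\<forall>\<^sub>F X in finite_subsets_at_top M. I X = (if km \<in> M then c km * ?V else 0)"
    unfolding eventually_finite_subsets_at_top
    by (rule exI[of _ "{km} \<inter> M"]) (auto simp: I_eq)
  then have "(I \<longlongrightarrow> (if km \<in> M then c km * ?V else 0)) (finite_subsets_at_top M)"
    by (rule tendsto_eventually)
  with lim have J_eq: "J = (if km \<in> M then c km * ?V else 0)"
    by (metis tendsto_unique finite_subsets_at_top_neq_bot)
  have "integral torus_cell (\<lambda>(x, t). f (y, cvec x, complex_of_real t) *
      inverse (harmonic km (cvec x) (complex_of_real t))) = J"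
  proof (rule integral_unique, rule has_integral_eq[OF _ J])
    fix z :: "(real ^ 'n) \<times> real"
    show "(\<Sum>\<^sub>\<infinity>l\<in>M. c l * ?e l z * inverse (?e km z)) = (case z of (x, t) \<Rightarrow>
        f (y, cvec x, complex_of_real t) * inverse (harmonic km (cvec x) (complex_of_real t)))"
      by (cases z) (simp only: f harmonic_real infsum_cmult_left' prod.case)
  qed
  then show ?thesis by (simp add: fcoeff_def J_eq)
qed

section \<open>Pointwise bounds by weighted Fourier norms\<close>

lemma norm_infsum_harmonics_le:
  fixes c :: "'n::finite mode \<Rightarrow> complex"
  shows "ennreal (norm (\<Sum>\<^sub>\<infinity>km\<in>M. c km * harmonic km (cvec x) (complex_of_real t)))
    \<le> (\<Sum>\<^sub>\<infinity>km\<in>M. ennreal (norm (c km)))"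
proof (cases "(\<lambda>km. norm (c km)) summable_on M")
  case True
  then have "norm (\<Sum>\<^sub>\<infinity>km\<in>M. c km * harmonic km (cvec x) (complex_of_real t)) \<le> (\<Sum>\<^sub>\<infinity>km\<in>M. norm (c km))"
    using norm_infsum_bound[of "\<lambda>km. c km * harmonic km (cvec x) (complex_of_real t)" M]
    by (simp add: norm_mult harmonic_real)
  moreover have "ennreal (\<Sum>\<^sub>\<infinity>km\<in>M. norm (c km)) = (\<Sum>\<^sub>\<infinity>km\<in>M. ennreal (norm (c km)))"
    using True infsum_comm_additive_general[of M ennreal "\<lambda>km. norm (c km)"]
    by (simp add: comp_def)
  ultimately show ?thesis by (metis ennreal_leI)
next
  \<comment> \<open>For complex series, unconditional and absolute summability agree. Without the
    latter the left-hand \<open>infsum\<close> takes its default value 0.\<close>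
  case False
  then have "\<not> (\<lambda>km. c km * harmonic km (cvec x) (complex_of_real t)) summable_on M"
    by (simp add: summable_on_iff_abs_summable_on_complex norm_mult harmonic_real)
  then show ?thesis by (simp add: infsum_not_exists)
qed

text \<open>
  No regularity of \<open>f\<close> is needed: for real angles, summability of the truncated series depends only on
  \<open>y\<close>, and where it fails \<open>infsum\<close> gives \<open>high_modes K f = 0\<close>.
\<close>

lemma norm_high_modes_le:
  fixes f :: "(complex, 'n::finite) phase \<Rightarrow> complex"
  shows "ennreal (norm (high_modes K f (y, cvec x, complex_of_real t)))
    \<le> (\<Sum>\<^sub>\<infinity>km\<in>UNIV. ennreal (norm (fcoeff (high_modes K f) km y)))"
proof -
  let ?M = "{km :: 'n mode. mode_size km > K}"
  let ?c = "\<lambda>km. fcoeff f km y"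
  show ?thesis
  proof (cases "(\<lambda>km. norm (?c km)) summable_on ?M")
    case True
    have "fcoeff (high_modes K f) km y = (if km \<in> ?M then ?c km else 0)" for km
      by (rule fcoeff_infsum_harmonics[OF True]) (simp add: high_modes_def)
    then have "(\<Sum>\<^sub>\<infinity>km\<in>?M. ennreal (norm (?c km))) =
        (\<Sum>\<^sub>\<infinity>km\<in>UNIV. ennreal (norm (fcoeff (high_modes K f) km y)))"
      by (intro infsum_cong_neutral) auto
    then show ?thesis
      using norm_infsum_harmonics_le[where c = ?c and M = ?M and x = x and t = t] by (simp add: high_modes_def)
  next
    case False
    then have "\<not> (\<lambda>km. ?c km * harmonic km (cvec x) (complex_of_real t)) summable_on ?M"
      by (simp add: summable_on_iff_abs_summable_on_complex norm_mult harmonic_real)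
    then show ?thesis by (simp add: high_modes_def infsum_not_exists)
  qed
qed

text \<open>For \<open>0 \<le> s\<close> every exponential weight is at least 1, so removing the
  weights can only decrease the sum.\<close>

lemma infsum_fcoeff_le_fnorm:
  assumes "y \<in> C_act r A" "0 \<le> s"
  shows "(\<Sum>\<^sub>\<infinity>km\<in>UNIV. ennreal (norm (fcoeff f km y))) \<le> fnorm A r s f"
  unfolding fnorm_def
proof (rule SUP_upper2[OF assms(1)], rule infsum_mono)
  fix km
  have "norm (fcoeff f km y) * 1 \<le> norm (fcoeff f km y) * exp (real (mode_size km) * s)"
    using assms(2) by (intro mult_left_mono) auto
  then show "ennreal (norm (fcoeff f km y)) \<le> ennreal (norm (fcoeff f km y) * exp (real (mode_size km) * s))"
    by (simp add: ennreal_leI)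
qed (simp_all add: nonneg_summable_on_complete)

lemma norm_le_fnorm_vec:
  assumes "\<And>j. ennreal (norm (v p $ j)) \<le> fnorm A r s (\<lambda>p. v p $ j)"
  shows "ennreal (norm (v p)) \<le> fnorm_vec A r s v"
proof (cases "\<exists>j. fnorm A r s (\<lambda>p. v p $ j) = \<infinity>")
  case False
  \<comment> \<open>\<open>enn2real\<close> sends an infinite value to 0, so this comparison relies
    on all component norms being finite.\<close>
  have "norm (v p $ j) \<le> enn2real (fnorm A r s (\<lambda>p. v p $ j))" for j
    using assms[of j] False by (metis enn2real_ennreal enn2real_mono infinity_ennreal_def norm_ge_zero top.not_eq_extremum)
  then have "norm (v p) \<le> sqrt (\<Sum>j\<in>UNIV. (enn2real (fnorm A r s (\<lambda>p. v p $ j)))\<^sup>2)"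
    unfolding norm_vec_def L2_set_def by (intro real_sqrt_le_mono sum_mono power_mono) auto
  then show ?thesis using False by (simp add: fnorm_vec_def ennreal_leI)
qed (simp add: fnorm_vec_def)

lemma norm_high_modes_vec_le_fnorm_vec:
  assumes "cvec (fst q) \<in> C_act r A" "0 \<le> s"
  shows "ennreal (norm (high_modes_vec K v (cphase q))) \<le> fnorm_vec A r s (high_modes_vec K v)"
proof (rule norm_le_fnorm_vec)
  fix j
  have "ennreal (norm (high_modes K (\<lambda>q. v q $ j) (cphase q))) \<le> fnorm A r s (high_modes K (\<lambda>q. v q $ j))"
    using order_trans[OF norm_high_modes_le infsum_fcoeff_le_fnorm[OF assms]]
    by (cases q) (simp add: cphase_def)
  then show "ennreal (norm (high_modes_vec K v (cphase q) $ j)) \<le> fnorm A r s (\<lambda>p. high_modes_vec K v p $ j)"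
    by (simp add: high_modes_vec_def)
qed

text \<open>Counterpart for functions that are not truncations, such as the remainder
  \<open>G\<close>: representation by the Fourier series links the value at a point to the
  coefficients.\<close>

lemma norm_fourier_series_le_fnorm_vec:
  assumes "fourier_series_on v S" "cphase q \<in> S" "cvec (fst q) \<in> C_act r A" "0 \<le> s"
  shows "ennreal (norm (v (cphase q))) \<le> fnorm_vec A r s v"
proof (rule norm_le_fnorm_vec)
  fix j
  obtain y x t where q: "q = (y, x, t)" by (cases q)
  have "((\<lambda>km. fcoeff (\<lambda>p. v p $ j) km (cvec y) * harmonic km (cvec x) (complex_of_real t))
      has_sum (v (cphase q) $ j)) UNIV"
    using assms(1,2) by (auto simp: fourier_series_on_def cphase_def q)
  then have "v (cphase q) $ j =
      (\<Sum>\<^sub>\<infinity>km\<in>UNIV. fcoeff (\<lambda>p. v p $ j) km (cvec y) * harmonic km (cvec x) (complex_of_real t))"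
    by (simp add: infsumI)
  then show "ennreal (norm (v (cphase q) $ j)) \<le> fnorm A r s (\<lambda>p. v p $ j)"
    using order_trans[OF norm_infsum_harmonics_le infsum_fcoeff_le_fnorm[OF assms(3,4)]] q by simp
qed

text \<open>\<open>G\<close> and \<open>G01\<close> are evaluated in the new coordinates, the
  truncations of the original perturbation in the old ones; hence both \<open>q\<close> and
  \<open>\<Xi>inv q\<close> must have actions in the complex neighbourhood.\<close>

lemma norm_nf_y_le:
  assumes "fourier_series_on G (cdom A r s)" "cphase q \<in> cdom A r s"
    and "cvec (fst (\<Xi>inv q)) \<in> C_act r A" "0 \<le> s" "0 \<le> \<epsilon>"
  shows "ennreal (norm (nf_y S K \<epsilon> \<mu> G G01 \<Xi>inv q)) \<le>
    fnorm_vec A r s G + fnorm_vec A r s (high_modes_vec K G01)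
    + ennreal \<epsilon> * fnorm_vec A r s (high_modes_vec K (grad_x (ham S)))
    + ennreal \<bar>\<mu>\<bar> * fnorm_vec A r s (high_modes_vec K (gpert S))"
proof -
  let ?g = "G (cphase q)" and ?g01 = "high_modes_vec K G01 (cphase q)"
    and ?h = "high_modes_vec K (grad_x (ham S)) (cphase (\<Xi>inv q))"
    and ?p = "high_modes_vec K (gpert S) (cphase (\<Xi>inv q))"
  have q: "cvec (fst q) \<in> C_act r A"
    using assms(2) by (cases q) (simp add: cphase_def cdom_def)
  have "norm (nf_y S K \<epsilon> \<mu> G G01 \<Xi>inv q) \<le> norm (?g + ?g01 - \<epsilon> *\<^sub>R ?h) + norm (\<mu> *\<^sub>R ?p)"
    unfolding nf_y_def by (rule norm_triangle_ineq)
  also have "norm (?g + ?g01 - \<epsilon> *\<^sub>R ?h) \<le> norm (?g + ?g01) + norm (\<epsilon> *\<^sub>R ?h)"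
    by (rule norm_triangle_ineq4)
  also have "norm (?g + ?g01) \<le> norm ?g + norm ?g01" by (rule norm_triangle_ineq)
  finally have "norm (nf_y S K \<epsilon> \<mu> G G01 \<Xi>inv q) \<le> norm ?g + norm ?g01 + \<epsilon> * norm ?h + \<bar>\<mu>\<bar> * norm ?p"
    using assms(5) by simp
  then have "ennreal (norm (nf_y S K \<epsilon> \<mu> G G01 \<Xi>inv q)) \<le>
      ennreal (norm ?g + norm ?g01 + \<epsilon> * norm ?h + \<bar>\<mu>\<bar> * norm ?p)"
    by (rule ennreal_leI)
  also have "\<dots> = ennreal (norm ?g) + ennreal (norm ?g01) + ennreal \<epsilon> * ennreal (norm ?h) + ennreal \<bar>\<mu>\<bar> * ennreal (norm ?p)"
    using assms(5) by (simp add: ennreal_plus ennreal_mult)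
  also have "\<dots> \<le> fnorm_vec A r s G + fnorm_vec A r s (high_modes_vec K G01)
    + ennreal \<epsilon> * fnorm_vec A r s (high_modes_vec K (grad_x (ham S)))
    + ennreal \<bar>\<mu>\<bar> * fnorm_vec A r s (high_modes_vec K (gpert S))"
    using norm_fourier_series_le_fnorm_vec[OF assms(1,2) q assms(4)]
      norm_high_modes_vec_le_fnorm_vec[OF q assms(4)] norm_high_modes_vec_le_fnorm_vec[OF assms(3,4)]
    by (intro add_mono mult_left_mono) auto
  finally show ?thesis .
qed

section \<open>Motion of the action along solutions\<close>

lemma norm_cvec: "norm (cvec v) = norm v"
  by (simp add: norm_vec_def cvec_def)

lemma cvec_in_C_act: "y \<in> A \<Longrightarrow> 0 \<le> r \<Longrightarrow> cvec y \<in> C_act r A"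
  by (force simp: C_act_def)

text \<open>By the chain rule the image curve has velocity \<open>D (v s)\<close>, and the mean
  value inequality integrates its bound. The bound is asked in the direction of the velocity only,
  which is where the normal form controls the differential.\<close>

lemma norm_diff_along_curve_le:
  fixes \<gamma> :: "real \<Rightarrow> 'a::real_normed_vector" and \<Phi> :: "'a \<Rightarrow> 'b::real_normed_vector"
  assumes \<gamma>: "\<And>s. s \<in> {0..t} \<Longrightarrow> (\<gamma> has_vector_derivative v s) (at s within {0..t})"
    and \<Phi>: "\<And>s. s \<in> {0..t} \<Longrightarrow> \<exists>D. (\<Phi> has_derivative D) (at (\<gamma> s)) \<and> norm (D (v s)) \<le> b"
    and "0 \<le> t"
  shows "norm (\<Phi> (\<gamma> t) - \<Phi> (\<gamma> 0)) \<le> b * t"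
proof -
  obtain D where D: "\<And>s. s \<in> {0..t} \<Longrightarrow> (\<Phi> has_derivative D s) (at (\<gamma> s)) \<and> norm (D s (v s)) \<le> b"
    using \<Phi> by metis
  have "norm (\<Phi> (\<gamma> t) - \<Phi> (\<gamma> 0)) \<le> b * norm (t - 0)"
  proof (rule differentiable_bound)
    fix s assume s: "s \<in> {0..t}"
    have "(\<Phi> \<circ> \<gamma> has_vector_derivative D s (v s)) (at s within {0..t})"
      using \<gamma>[OF s] D[OF s] vector_derivative_diff_chain_within has_derivative_at_withinI by blast
    then show "((\<lambda>s. \<Phi> (\<gamma> s)) has_derivative (\<lambda>h. h *\<^sub>R D s (v s))) (at s within {0..t})"
      by (simp add: has_vector_derivative_def comp_def)
    show "onorm (\<lambda>h. h *\<^sub>R D s (v s)) \<le> b"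
      using D[OF s] by (intro onorm_le) (simp add: mult.commute[of b] mult_left_mono)
  qed (use \<open>0 \<le> t\<close> in auto)
  then show ?thesis using \<open>0 \<le> t\<close> by simp
qed

text \<open>The growth linear in \<open>t\<close> is kept explicit for one fixed order
  \<open>N\<close>, which leaves the time horizon to be chosen afterwards.\<close>

lemma action_variation_le:
  assumes nf: "normal_form_order S \<eta> r0 s0 K \<tau> P N C\<omega> CY Cp"
    and P: "(\<epsilon>, \<mu>) \<in> P" and "0 \<le> \<epsilon>" "0 \<le> CY"
    and sol: "is_solution S \<eta> \<epsilon> \<mu> T y x" and t: "0 \<le> t" "t \<le> T"
  shows "norm (y t - y 0) \<le> (2 * Cp + CY * exp (- (real K * \<tau>)) * t) * lam \<epsilon> \<mu>"
proof -
  let ?A = "act_dom S" and ?L = "lam \<epsilon> \<mu>"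
  \<comment> \<open>This speed is the exponential form of the remainder estimate, rather than the
    one with \<open>L ^ (N + 1)\<close>.\<close>
  let ?b = "CY * ?L * exp (- (real K * \<tau>))"
  from nf P obtain \<Xi> \<Omega>d F F01 G G01 R0 S0 r1 where
    brings: "brings_into_normal_form S \<eta> K \<epsilon> \<mu> \<Xi> \<Omega>d F F01 G G01"
    and analytic: "\<forall>H\<in>{F, G, F01, G01}. canalytic_vec_on H (cdom ?A R0 S0) \<and>
      periodic_on H (cdom ?A R0 S0) \<and> fourier_series_on H (cdom ?A R0 S0)"
    and range: "\<forall>p\<in>rdom ?A. cphase (\<Xi> p) \<in> cdom ?A R0 S0 \<and> cvec (fst (\<Xi> p)) \<in> C_act r1 ?A"
    and bound: "fnorm_vec ?A R0 S0 G + fnorm_vec ?A R0 S0 (high_modes_vec K G01)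
      + ennreal \<epsilon> * fnorm_vec ?A R0 S0 (high_modes_vec K (grad_x (ham S)))
      + ennreal \<bar>\<mu>\<bar> * fnorm_vec ?A R0 S0 (high_modes_vec K (gpert S)) \<le> ennreal ?b"
    and near: "\<forall>p\<in>rdom ?A. norm (fst (\<Xi> p) - fst p) \<le> Cp * ?L"
    and R0: "0 < R0" and S0: "0 < S0"
    unfolding normal_form_order_def Let_def
    apply -
    apply (elim exE conjE, drule (1) bspec)
    apply (unfold prod.case, elim conjE)
    apply (rule that; assumption)
    done
  then have four: "fourier_series_on G (cdom ?A R0 S0)" by blast
  \<comment> \<open>The trajectory in extended phase space: time is a coordinate of speed 1, so its
    velocity is exactly the vector that the differential of \<open>\<Xi>\<close> transforms.\<close>
  let ?\<gamma> = "\<lambda>s. (y s, x s, s)"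
  have in_A: "?\<gamma> s \<in> rdom ?A" if "s \<in> {0..t}" for s
    using sol that t by (simp add: is_solution_def rdom_def)
  have "norm (fst (\<Xi> (?\<gamma> t)) - fst (\<Xi> (?\<gamma> 0))) \<le> ?b * t"
  proof (rule norm_diff_along_curve_le[where \<Phi> = "\<lambda>p. fst (\<Xi> p)" and \<gamma> = ?\<gamma>])
    fix s assume s: "s \<in> {0..t}"
    let ?v = "(vf_y S \<eta> \<epsilon> \<mu> (?\<gamma> s), vf_x S \<epsilon> \<mu> (?\<gamma> s), 1)"
    have sub: "{0..t} \<subseteq> {0..T}" using t by auto
    have "s \<in> {0..T}" using s t by auto
    then have "(y has_vector_derivative vf_y S \<eta> \<epsilon> \<mu> (?\<gamma> s)) (at s within {0..t})"
      "(x has_vector_derivative vf_x S \<epsilon> \<mu> (?\<gamma> s)) (at s within {0..t})"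
      using sol sub unfolding is_solution_def by (blast intro: has_vector_derivative_within_subset)+
    then show "(?\<gamma> has_vector_derivative ?v) (at s within {0..t})"
      by (intro has_vector_derivative_Pair has_vector_derivative_id)
    let ?inv = "inv_into (rdom ?A) \<Xi>"
    \<comment> \<open>Injectivity of \<open>\<Xi>\<close> returns the trajectory itself, whose
      actions are real points of the domain and so lie in every complex neighbourhood of it.\<close>
    have inv: "?inv (\<Xi> (?\<gamma> s)) = ?\<gamma> s"
      using brings in_A[OF s] by (simp add: brings_into_normal_form_def)
    obtain D Y' X' where D: "(\<Xi> has_derivative D) (at (?\<gamma> s))" and Dv: "D ?v = (Y', X', 1)"
      and Y': "cvec Y' = nf_y S K \<epsilon> \<mu> G G01 ?inv (\<Xi> (?\<gamma> s))"
      using brings in_A[OF s] unfolding brings_into_normal_form_def by blast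
    have in_dom: "cphase (\<Xi> (?\<gamma> s)) \<in> cdom ?A R0 S0"
      using range in_A[OF s] by blast
    have "cvec (fst (?inv (\<Xi> (?\<gamma> s)))) \<in> C_act R0 ?A"
      unfolding inv using in_A[OF s] R0 by (simp add: rdom_def cvec_in_C_act)
    with four in_dom have "ennreal (norm (cvec Y')) \<le> ennreal ?b"
      unfolding Y' using S0 \<open>0 \<le> \<epsilon>\<close> by (intro order_trans[OF norm_nf_y_le bound]) auto
    \<comment> \<open>Returning from \<open>ennreal\<close> to the reals uses that \<open>?b\<close>
      is nonnegative.\<close>
    then have "norm Y' \<le> ?b"
      using \<open>0 \<le> \<epsilon>\<close> \<open>0 \<le> CY\<close> by (simp add: norm_cvec lam_def)
    then show "\<exists>D. ((\<lambda>p. fst (\<Xi> p)) has_derivative D) (at (?\<gamma> s)) \<and> norm (D ?v) \<le> ?b"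
      using has_derivative_fst[OF D] Dv by (intro exI[of _ "\<lambda>h. fst (D h)"]) simp
  qed (use t in simp)
  moreover have "norm (fst (\<Xi> (?\<gamma> t)) - y t) \<le> Cp * ?L" "norm (fst (\<Xi> (?\<gamma> 0)) - y 0) \<le> Cp * ?L"
    using near in_A[of t] in_A[of 0] t by force+
  moreover have "norm (y t - y 0) \<le> norm (fst (\<Xi> (?\<gamma> t)) - fst (\<Xi> (?\<gamma> 0)))
      + norm (fst (\<Xi> (?\<gamma> t)) - y t) + norm (fst (\<Xi> (?\<gamma> 0)) - y 0)"
    by norm
  ultimately have "norm (y t - y 0) \<le> ?b * t + Cp * ?L + Cp * ?L"
    by linarith
  then show ?thesis by (simp add: algebra_simps)
qed

text \<open>\<open>\<rho>0\<close> and \<open>Ct\<close> are chosen before the system, with the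
  values of the norms fixed beforehand; this expresses on what they may depend. They are functions
  of the order, which varies with the parameters. The rate \<open>\<tau>0\<close> is taken from the
  assumed normal form.\<close>

theorem mainTheorem2:
  fixes r0 s0 \<epsilon>0 \<mu>0 :: real and K :: nat
    and n\<omega> nh nf ng :: ennreal
    and C\<omega> CY Cp :: "nat \<Rightarrow> real"
  assumes "0 < r0" "0 < s0" "0 < \<epsilon>0" "0 < \<mu>0" "1 \<le> K"
    and "\<And>N. 0 < C\<omega> N" "\<And>N. 0 < CY N" "\<And>N. 0 < Cp N"
  shows "\<exists>(\<rho>0 :: nat \<Rightarrow> real) (Ct :: nat \<Rightarrow> real). (\<forall>N. 0 < \<rho>0 N \<and> 0 < Ct N) \<and>
    (\<forall>(S :: 'n::finite system) D a \<eta>.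
       analytic_system S r0 s0 \<and>
       sup_norm (act_dom S) r0 (freq S) = n\<omega> \<and> fnorm (act_dom S) r0 s0 (ham S) = nh \<and>
       fnorm_vec (act_dom S) r0 s0 (fpert S) = nf \<and> fnorm_vec (act_dom S) r0 s0 (gpert S) = ng \<and>
       D \<subseteq> act_dom S \<and> 0 < a \<and> nonresonant_on S D K a \<and>
       (\<exists>\<tau>>0. normal_form_lemma S \<eta> r0 s0 K \<epsilon>0 \<mu>0 C\<omega> CY Cp \<tau>) \<longrightarrow>
       (\<exists>\<tau>0>0. normal_form_lemma S \<eta> r0 s0 K \<epsilon>0 \<mu>0 C\<omega> CY Cp \<tau>0 \<and>
          (\<forall>\<epsilon> \<mu> T y x. admissible \<epsilon>0 \<mu>0 \<epsilon> \<mu> \<and> is_solution S \<eta> \<epsilon> \<mu> T y x \<and> y 0 \<in> D \<longrightarrow>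
             (let N = normal_order K \<tau>0 \<epsilon> \<mu> in
              \<forall>t. 0 < t \<and> t \<le> T \<and> t \<le> Ct N * exp (real K * \<tau>0) \<longrightarrow>
                norm (y t - y 0) \<le> \<rho>0 N * lam \<epsilon> \<mu>))))"
proof (rule exI[of _ "\<lambda>N. 2 * Cp N + CY N"], rule exI[of _ "\<lambda>N. 1"], intro conjI allI impI)
  \<comment> \<open>\<open>2 * Cp N\<close> pays for the coordinate change at the two endpoints,
    \<open>CY N\<close> for the motion between them. With \<open>Ct = 1\<close> the time
    \<open>exp (real K * \<tau>)\<close> exactly cancels the exponentially small speed.\<close>
  let ?\<rho> = "\<lambda>N. 2 * Cp N + CY N" and ?Ct = "\<lambda>N :: nat. 1 :: real"
  show "0 < ?\<rho> N" "0 < ?Ct N" for N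
    using assms(7,8)[of N] by simp_all
  fix S :: "'n system" and D a \<eta>
  assume "analytic_system S r0 s0 \<and>
       sup_norm (act_dom S) r0 (freq S) = n\<omega> \<and> fnorm (act_dom S) r0 s0 (ham S) = nh \<and>
       fnorm_vec (act_dom S) r0 s0 (fpert S) = nf \<and> fnorm_vec (act_dom S) r0 s0 (gpert S) = ng \<and>
       D \<subseteq> act_dom S \<and> 0 < a \<and> nonresonant_on S D K a \<and>
       (\<exists>\<tau>>0. normal_form_lemma S \<eta> r0 s0 K \<epsilon>0 \<mu>0 C\<omega> CY Cp \<tau>)"
  then obtain \<tau> where "0 < \<tau>" and nf: "normal_form_lemma S \<eta> r0 s0 K \<epsilon>0 \<mu>0 C\<omega> CY Cp \<tau>"
    by blast
  have "norm (y t - y 0) \<le> ?\<rho> N * lam \<epsilon> \<mu>"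
    if adm: "admissible \<epsilon>0 \<mu>0 \<epsilon> \<mu>" and sol: "is_solution S \<eta> \<epsilon> \<mu> T y x"
      and N: "N = normal_order K \<tau> \<epsilon> \<mu>"
      and t: "0 < t" "t \<le> T" "t \<le> ?Ct N * exp (real K * \<tau>)" for \<epsilon> \<mu> T y x t N
  proof -
    \<comment> \<open>The order is dictated by the parameters: \<open>(\<epsilon>, \<mu>)\<close>
      belongs to the family on which order \<open>N\<close> is used.\<close>
    have "normal_form_order S \<eta> r0 s0 K \<tau>
        {(\<epsilon>, \<mu>). admissible \<epsilon>0 \<mu>0 \<epsilon> \<mu> \<and> normal_order K \<tau> \<epsilon> \<mu> = N} N (C\<omega> N) (CY N) (Cp N)"
      using nf by (simp add: normal_form_lemma_def)
    then have "norm (y t - y 0) \<le> (2 * Cp N + CY N * exp (- (real K * \<tau>)) * t) * lam \<epsilon> \<mu>"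
      using adm assms(7)[of N] sol t N
      by (intro action_variation_le) (auto simp: admissible_def)
    also have "\<dots> \<le> (2 * Cp N + CY N) * lam \<epsilon> \<mu>"
    proof (intro mult_right_mono add_left_mono)
      have "CY N * exp (- (real K * \<tau>)) * t \<le> CY N * exp (- (real K * \<tau>)) * exp (real K * \<tau>)"
        using t(3) assms(7)[of N] by (intro mult_left_mono) auto
      then show "CY N * exp (- (real K * \<tau>)) * t \<le> CY N"
        by (simp add: mult.assoc flip: exp_add)
    qed (simp add: lam_def)
    finally show ?thesis .
  qed
  with \<open>0 < \<tau>\<close> nf show "\<exists>\<tau>0>0. normal_form_lemma S \<eta> r0 s0 K \<epsilon>0 \<mu>0 C\<omega> CY Cp \<tau>0 \<and>
          (\<forall>\<epsilon> \<mu> T y x. admissible \<epsilon>0 \<mu>0 \<epsilon> \<mu> \<and> is_solution S \<eta> \<epsilon> \<mu> T y x \<and> y 0 \<in> D \<longrightarrow>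
             (let N = normal_order K \<tau>0 \<epsilon> \<mu> in
              \<forall>t. 0 < t \<and> t \<le> T \<and> t \<le> ?Ct N * exp (real K * \<tau>0) \<longrightarrow>
                norm (y t - y 0) \<le> ?\<rho> N * lam \<epsilon> \<mu>))"
    unfolding Let_def by (intro exI[of _ \<tau>]) blast
qed

end
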